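(* For every integer $d\geq 3$ there exist a family $(G_i)_{i \geq 1}$ of $d$-regular graphs with $n_i := |V(G_i)| \to \infty$ and a constant $c>0$ such that for all $i$: (1) $\mathrm{sn}(G_i) \ge c\, n_i$ (that is, $\mathrm{sn}(G)=\Omega(n)$), and (2) $\mathrm{cart}(G_i) \ge 2^{c\sqrt{n_i}}$ (that is, $\mathrm{cart}(G)=2^{\Omega(\sqrt{n})}$).
   Context: A graph is a finite, connected, loopless multigraph; it is $d$-regular if every vertex has degree $d$. A scramble $\mathcal{S}$ on $G$ is a nonempty collection (set) of nonempty connected subgraphs of $G$, called eggs; its size $|\mathcal{S}|$ is the number of eggs. The hitting number $h(\mathcal{S})$ is the minimum size of a set of vertices meeting the vertex set of every egg. An egg-cut is a set of edges whose deletion disconnects $G$ so that two different components each contain an egg; the egg-cut number $e(\mathcal{S})$ is the minimum size of an egg-cut, with $e(\mathcal{S})=\infty$ if none exists. The order is $\|\mathcal{S}\|=\min\{h(\mathcal{S}),e(\mathcal{S})\}$. The scramble number $\mathrm{sn}(G)$ is the maximum order of a scramble on $G$. The carton number is $\mathrm{cart}(G)=\min\{|\mathcal{S}| : \mathcal{S}\text{ a scramble on }G,\ \|\mathcal{S}\|=\mathrm{sn}(G)\}$. *)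

theory Defs
  imports Complex_Main "HOL-Library.Extended_Nat"
begin

section \<open>Finite loopless multigraphs\<close>

text \<open>Edges have an identity of their own, so that parallel edges are allowed;
  \<open>ends G e\<close> is the set of endpoints of \<open>e\<close>. Only its values on \<open>edges G\<close> matter.\<close>

record ('v, 'e) mgraph =
  verts :: "'v set"
  edges :: "'e set"
  ends :: "'e \<Rightarrow> 'v set"

text \<open>The condition \<open>card (ends G e) = 2\<close> says that there are no loops.\<close>

definition wf_mgraph :: "('v, 'e) mgraph \<Rightarrow> bool" where
  "wf_mgraph G \<longleftrightarrow> finite (verts G) \<and> finite (edges G) \<and>
     (\<forall>e\<in>edges G. ends G e \<subseteq> verts G \<and> card (ends G e) = 2)"

definition adj :: "('v, 'e) mgraph \<Rightarrow> ('v \<times> 'v) set" where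
  "adj G = {(u, v). \<exists>e\<in>edges G. ends G e = {u, v}}"

text \<open>A connected graph is nonempty.\<close>

definition connected_mgraph :: "('v, 'e) mgraph \<Rightarrow> bool" where
  "connected_mgraph G \<longleftrightarrow>
     verts G \<noteq> {} \<and> (\<forall>u\<in>verts G. \<forall>v\<in>verts G. (u, v) \<in> (adj G)\<^sup>*)"

definition graph :: "('v, 'e) mgraph \<Rightarrow> bool" where
  "graph G \<longleftrightarrow> wf_mgraph G \<and> connected_mgraph G"

definition degree :: "('v, 'e) mgraph \<Rightarrow> 'v \<Rightarrow> nat" where
  "degree G v = card {e \<in> edges G. v \<in> ends G e}"

definition regular :: "nat \<Rightarrow> ('v, 'e) mgraph \<Rightarrow> bool" where
  "regular d G \<longleftrightarrow> (\<forall>v\<in>verts G. degree G v = d)"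

text \<open>A subgraph inherits the whole function \<open>ends G\<close>. It is thus determined by its vertices
  and edges, and counting records is the same as counting subgraphs.\<close>

definition subgraph :: "('v, 'e) mgraph \<Rightarrow> ('v, 'e) mgraph \<Rightarrow> bool" where
  "subgraph H G \<longleftrightarrow> wf_mgraph H \<and> verts H \<subseteq> verts G \<and> edges H \<subseteq> edges G \<and> ends H = ends G"

definition delete_edges :: "('v, 'e) mgraph \<Rightarrow> 'e set \<Rightarrow> ('v, 'e) mgraph" where
  "delete_edges G F = G\<lparr>edges := edges G - F\<rparr>"

text \<open>The components are the maximal connected subgraphs.\<close>

definition components :: "('v, 'e) mgraph \<Rightarrow> ('v, 'e) mgraph set" where
  "components G = {C. subgraph C G \<and> connected_mgraph C \<and>
     (\<forall>D. subgraph D G \<and> connected_mgraph D \<and> subgraph C D \<longrightarrow> D = C)}"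

section \<open>Scrambles\<close>

definition scramble :: "('v, 'e) mgraph \<Rightarrow> ('v, 'e) mgraph set \<Rightarrow> bool" where
  "scramble G S \<longleftrightarrow> S \<noteq> {} \<and> (\<forall>E\<in>S. subgraph E G \<and> connected_mgraph E)"

definition hitting_set :: "('v, 'e) mgraph \<Rightarrow> ('v, 'e) mgraph set \<Rightarrow> 'v set \<Rightarrow> bool" where
  "hitting_set G S X \<longleftrightarrow> X \<subseteq> verts G \<and> (\<forall>E\<in>S. X \<inter> verts E \<noteq> {})"

definition hitting_number :: "('v, 'e) mgraph \<Rightarrow> ('v, 'e) mgraph set \<Rightarrow> nat" where
  "hitting_number G S = Min {card X |X. hitting_set G S X}"

definition egg_cut :: "('v, 'e) mgraph \<Rightarrow> ('v, 'e) mgraph set \<Rightarrow> 'e set \<Rightarrow> bool" where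
  "egg_cut G S F \<longleftrightarrow> F \<subseteq> edges G \<and>
     (\<exists>C\<^sub>1\<in>components (delete_edges G F). \<exists>C\<^sub>2\<in>components (delete_edges G F). C\<^sub>1 \<noteq> C\<^sub>2 \<and>
        (\<exists>E\<in>S. subgraph E C\<^sub>1) \<and> (\<exists>E\<in>S. subgraph E C\<^sub>2))"

text \<open>The infimum of the empty set in \<^typ>\<open>enat\<close> is \<open>\<infinity>\<close>, as required if there is no egg-cut.\<close>

definition egg_cut_number :: "('v, 'e) mgraph \<Rightarrow> ('v, 'e) mgraph set \<Rightarrow> enat" where
  "egg_cut_number G S = Inf {enat (card F) |F. egg_cut G S F}"

definition scramble_order :: "('v, 'e) mgraph \<Rightarrow> ('v, 'e) mgraph set \<Rightarrow> enat" where
  "scramble_order G S = min (enat (hitting_number G S)) (egg_cut_number G S)"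

text \<open>The order of a scramble is at most its hitting number, hence finite and at most the number
  of vertices, so the following maximum ranges over a finite set of natural numbers.\<close>

definition sn :: "('v, 'e) mgraph \<Rightarrow> nat" where
  "sn G = Max {k. \<exists>S. scramble G S \<and> scramble_order G S = enat k}"

definition cart :: "('v, 'e) mgraph \<Rightarrow> nat" where
  "cart G = Min {card S |S. scramble G S \<and> scramble_order G S = enat (sn G)}"

end

theory Submission
  imports Defs "HOL-Combinatorics.Permutations"
begin

text \<open>An egg \<open>E\<close> of a scramble of order \<open>s\<close> has at least \<open>s / d\<close> vertices: otherwise \<open>E\<close> is too
  small to be a hitting set, so that some egg is disjoint from \<open>E\<close>, and the fewer than \<open>s\<close> edges
  leaving \<open>E\<close> are an egg-cut. If \<open>s\<close> is linear in \<open>n\<close>, each egg thus contains a constant fraction of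
  the vertices, and greedily chosen vertices hit a constant fraction of the remaining eggs each.
  As \<open>s - 1\<close> of them do not hit all eggs, the number of eggs is even exponential in \<open>n\<close>, not only
  in \<open>sqrt n\<close>.

  The scramble number is linear if all vertex sets of size between \<open>n / 4\<close> and \<open>n / 2\<close> have a linear
  edge boundary. A cycle together with a random perfect matching between its two halves is
  such a graph: few sets have a small boundary in the cycle, and for each of them an
  exponentially small fraction of all matchings has few crossing edges. Repeating the matching
  \<open>d - 2\<close> times makes the graph \<open>d\<close>-regular.\<close>

section \<open>A cycle with a matching expands sets of linear size\<close>

text \<open>The sum of \<open>x ^ card D\<close> over all subsets \<open>D\<close> of
  \<open>U\<close> is \<open>(1 + x) ^ card U\<close>, and since \<open>x \<le> 1\<close>, each
  subset of size at most \<open>t\<close> contributes at least \<open>x ^ t\<close>.\<close>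

lemma card_small_subsets:
  fixes x :: real
  assumes "finite U" "0 < x" "x \<le> 1"
  shows "real (card {D. D \<subseteq> U \<and> card D \<le> t}) * x ^ t \<le> (1 + x) ^ card U"
proof -
  have total: "(\<Sum>D\<in>Pow U. x ^ card D) = (1 + x) ^ card U"
    using assms(1)
  proof (induction U)
    case empty
    then show ?case by simp
  next
    case (insert a U)
    have "(\<Sum>D\<in>Pow (insert a U). x ^ card D)
        = (\<Sum>D\<in>Pow U. x ^ card D) + (\<Sum>D\<in>insert a ` Pow U. x ^ card D)"
      unfolding Pow_insert using insert.hyps by (intro sum.union_disjoint) auto
    also have "(\<Sum>D\<in>insert a ` Pow U. x ^ card D) = (\<Sum>D\<in>Pow U. x ^ card (insert a D))"
      using insert.hyps by (subst sum.reindex) (auto simp: inj_on_def o_def)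
    also have "\<dots> = (\<Sum>D\<in>Pow U. x * x ^ card D)"
    proof (rule sum.cong)
      fix D assume "D \<in> Pow U"
      then have "finite D" "a \<notin> D" using insert.hyps finite_subset by auto
      then show "x ^ card (insert a D) = x * x ^ card D" by simp
    qed simp
    finally show ?case
      using insert by (simp add: sum_distrib_left[symmetric] algebra_simps)
  qed
  have "real (card {D. D \<subseteq> U \<and> card D \<le> t}) * x ^ t = (\<Sum>D\<in>{D. D \<subseteq> U \<and> card D \<le> t}. x ^ t)"
    by simp
  also have "\<dots> \<le> (\<Sum>D\<in>{D. D \<subseteq> U \<and> card D \<le> t}. x ^ card D)"
    using assms by (intro sum_mono power_decreasing) auto
  also have "\<dots> \<le> (\<Sum>D\<in>Pow U. x ^ card D)"
    using assms by (intro sum_mono2) auto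
  finally show ?thesis using total by simp
qed

lemma ex_permutes_image:
  assumes "finite U" "A \<subseteq> U" "B \<subseteq> U" "card A = card B"
  obtains p where "p permutes U" "p ` A = B"
proof -
  have fin: "finite A" "finite B" using assms finite_subset by auto
  obtain f where f: "bij_betw f A B" using fin assms(4) finite_same_card_bij by blast
  have "card (U - A) = card (U - B)"
    using assms fin by (simp add: card_Diff_subset)
  then obtain g where g: "bij_betw g (U - A) (U - B)"
    using assms(1) finite_same_card_bij by (metis finite_Diff)
  define p where "p x = (if x \<in> A then f x else if x \<in> U then g x else x)" for x
  have A: "bij_betw p A B"
    using f by (rule bij_betw_cong[THEN iffD1, rotated]) (simp add: p_def)
  have "bij_betw p (U - A) (U - B)"
    using g by (rule bij_betw_cong[THEN iffD1, rotated]) (simp add: p_def)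
  with A have "bij_betw p (A \<union> (U - A)) (B \<union> (U - B))"
    by (rule bij_betw_combine) auto
  then have "bij_betw p U U" using assms by (simp add: Un_absorb1)
  then have "p permutes U"
    by (rule bij_imp_permutes) (use assms in \<open>auto simp: p_def\<close>)
  with A show thesis using that by (auto simp: bij_betw_def)
qed

text \<open>All sets of size \<open>card A\<close> are equally likely images of \<open>A\<close>:
  composing with a permutation that takes \<open>B\<close> to \<open>C\<close> embeds the
  permutations with image \<open>B\<close> into those with image \<open>C\<close>. Permutations with
  different images are different, so the counts add up to at most the number of all
  permutations.\<close>

lemma card_permutes_image_le:
  assumes U: "finite U" and "A \<subseteq> U" "B \<subseteq> U" "card B = card A"
  shows "(card U choose card A) * card {p. p permutes U \<and> p ` A = B} \<le> fact (card U)"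
proof -
  define N where "N C = {p. p permutes U \<and> p ` A = C}" for C
  define \<C> where "\<C> = {C. C \<subseteq> U \<and> card C = card A}"
  have finN: "finite (N C)" for C
    unfolding N_def using finite_permutations[OF U] by simp
  have le: "card (N B) \<le> card (N C)" if "C \<in> \<C>" for C
  proof -
    obtain q where q: "q permutes U" "q ` B = C"
      by (rule ex_permutes_image[OF U \<open>B \<subseteq> U\<close>, of C]) (use \<open>C \<in> \<C>\<close> assms(4) in \<open>auto simp: \<C>_def\<close>)
    have "inj_on (\<lambda>p. q \<circ> p) (N B)"
      using permutes_inj[OF q(1)] by (auto simp: inj_on_def fun_eq_iff)
    moreover have "(\<lambda>p. q \<circ> p) ` N B \<subseteq> N C"
      using q by (auto simp: N_def image_comp[symmetric] intro: permutes_compose)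
    ultimately show ?thesis using finN by (metis card_inj_on_le)
  qed
  have "(card U choose card A) * card (N B) = (\<Sum>C\<in>\<C>. card (N B))"
    using n_subsets[OF U] by (simp add: \<C>_def)
  also have "\<dots> \<le> (\<Sum>C\<in>\<C>. card (N C))"
    using le by (rule sum_mono)
  also have "\<dots> = card (\<Union>C\<in>\<C>. N C)"
    using U finN by (intro card_UN_disjoint[symmetric]) (auto simp: \<C>_def N_def)
  also have "\<dots> \<le> card {p. p permutes U}"
    using finite_permutations[OF U] by (intro card_mono) (auto simp: N_def)
  also have "\<dots> = fact (card U)" using U by (simp add: card_permutations)
  finally show ?thesis by (simp add: N_def)
qed

text \<open>For \<open>2 * j \<le> n\<close> the binomial coefficient is at least
  \<open>(n / j) ^ j\<close>, hence at least \<open>2 ^ j\<close>; the other half follows by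
  symmetry.\<close>

lemma power2_le_binomial:
  assumes "k \<le> n" "q \<le> k" "q \<le> n - k"
  shows "2 ^ q \<le> n choose k"
proof -
  have *: "2 ^ j \<le> n choose j" if "2 * j \<le> n" for j
  proof (cases "j = 0")
    case False
    have "(2::real) ^ j \<le> (real n / real j) ^ j"
      using that False by (intro power_mono) (auto simp: field_simps)
    also have "\<dots> \<le> real (n choose j)"
      using that by (intro binomial_ge_n_over_k_pow_k) auto
    finally show ?thesis
      by (metis of_nat_le_iff of_nat_numeral of_nat_power)
  qed simp
  show ?thesis
  proof (cases "2 * k \<le> n")
    case True
    then show ?thesis using *[of k] assms
      by (meson le_trans one_le_numeral power_increasing)
  next
    case False
    then have "2 ^ (n - k) \<le> n choose (n - k)" by (intro *) auto
    then show ?thesis using assms binomial_symmetric[of k n]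
      by (metis le_trans one_le_numeral power_increasing)
  qed
qed

section \<open>Sets with few boundary edges in the cycle or the matching\<close>

text \<open>The number \<open>i\<close> stands for the cycle edge from \<open>i\<close> to its
  successor, so these are the cycle edges with exactly one end in \<open>A\<close>.\<close>

definition cycle_boundary :: "nat \<Rightarrow> nat set \<Rightarrow> nat set" where
  "cycle_boundary n A = {i. i < n \<and> (i \<in> A) \<noteq> (Suc i mod n \<in> A)}"

text \<open>Walking along the cycle from \<open>0\<close>, membership changes exactly at the
  boundary edges. Sets with a small boundary are therefore few.\<close>

lemma inj_on_cycle_boundary:
  "inj_on (\<lambda>A. (0 \<in> A, cycle_boundary n A)) (Pow {..<n})"
proof (rule inj_onI)
  fix A B assume AB: "A \<in> Pow {..<n}" "B \<in> Pow {..<n}"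
    and eq: "(0 \<in> A, cycle_boundary n A) = (0 \<in> B, cycle_boundary n B)"
  have "i < n \<Longrightarrow> i \<in> A \<longleftrightarrow> i \<in> B" for i
  proof (induction i)
    case 0
    then show ?case using eq by simp
  next
    case (Suc i)
    moreover have "i \<in> cycle_boundary n A \<longleftrightarrow> i \<in> cycle_boundary n B" using eq by simp
    ultimately show ?case by (auto simp: cycle_boundary_def)
  qed
  with AB show "A = B" by auto
qed

text \<open>The number \<open>i\<close> stands for the matching edge from \<open>i\<close> in the
  lower half to \<open>m + p i\<close> in the upper half.\<close>

definition crossing :: "nat \<Rightarrow> (nat \<Rightarrow> nat) \<Rightarrow> nat set \<Rightarrow> nat set" where
  "crossing m p A = {i. i < m \<and> (i \<in> A) \<noteq> (m + p i \<in> A)}"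

text \<open>A permutation with few crossings maps the lower half of \<open>A\<close> to a set that
  differs in few elements from the upper half, which leaves few possibilities for the image.\<close>

lemma card_few_crossings:
  fixes m t :: nat
  assumes m: "m = 128 * t" and A: "A \<subseteq> {..<2 * m}" "m \<le> 2 * card A" "card A \<le> m"
  shows "2 ^ (31 * t) * card {p. p permutes {..<m} \<and> card (crossing m p A) \<le> t}
    \<le> card {D. D \<subseteq> {..<m} \<and> card D \<le> t} * fact m"
proof -
  let ?U = "{..<m}"
  define A0 where "A0 = A \<inter> ?U"
  define A1 where "A1 = {j. j < m \<and> m + j \<in> A}"
  define bad where "bad = {p. p permutes ?U \<and> card (crossing m p A) \<le> t}"
  define \<D> where "\<D> = {D. D \<subseteq> ?U \<and> card D \<le> t}"
  have fin: "finite A0" "finite A1" "finite \<D>" by (auto simp: A0_def A1_def \<D>_def)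
  have cardA: "card A = card A0 + card A1"
  proof -
    have "A = A0 \<union> (\<lambda>j. m + j) ` A1"
      using A(1) unfolding A0_def A1_def
      by (auto simp: image_iff) (metis add_less_cancel_left le_Suc_ex lessThan_iff mult_2 not_less subsetD)
    moreover have "A0 \<inter> (\<lambda>j. m + j) ` A1 = {}" by (auto simp: A0_def)
    ultimately have "card A = card A0 + card ((\<lambda>j. m + j) ` A1)"
      using fin by (metis card_Un_disjoint finite_imageI)
    then show ?thesis by (simp add: card_image)
  qed
  \<comment> \<open>\<open>A1\<close> is the upper half of \<open>A\<close>, shifted down by
    \<open>m\<close>; a crossing edge is one whose upper end distinguishes it from the image of the
    lower half.\<close>
  have sub: "sym_diff (p ` A0) A1 = p ` crossing m p A" if "p permutes ?U" for p
  proof -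
    have "p i \<in> sym_diff (p ` A0) A1 \<longleftrightarrow> i \<in> crossing m p A" for i
      using permutes_in_image[OF that, of i] permutes_inj[OF that]
      by (auto simp: A0_def A1_def crossing_def inj_image_mem_iff)
    then show ?thesis
      using permutes_surj[OF that] by (auto simp: image_iff) (metis surjD)+
  qed
  show ?thesis
  \<comment> \<open>The binomial bound needs halves of nearly equal size. A single bad permutation
    already forces this, and without one there is nothing to count.\<close>
  proof (cases "bad = {}")
    case True
    then show ?thesis unfolding bad_def[symmetric] by simp
  next
    case False
    then obtain p where p: "p permutes ?U" "card (crossing m p A) \<le> t" by (auto simp: bad_def)
    have cardp: "card (p ` A0) = card A0"
      using permutes_inj[OF p(1)] by (meson card_image inj_on_subset subset_UNIV)
    have "card (sym_diff (p ` A0) A1) \<le> t"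
      using sub[OF p(1)] p(2) card_image_le[of "crossing m p A" p] by (simp add: crossing_def)
    then have "card (p ` A0 - A1) \<le> t" "card (A1 - p ` A0) \<le> t"
      using fin by (meson card_mono finite_Diff finite_UnI finite_imageI le_trans sup_ge1 sup_ge2)+
    moreover have "card (p ` A0) - card A1 \<le> card (p ` A0 - A1)" "card A1 - card (p ` A0) \<le> card (A1 - p ` A0)"
      using fin by (auto intro!: diff_card_le_card_Diff)
    ultimately have close: "card A0 \<le> card A1 + t" "card A1 \<le> card A0 + t"
      using cardp by auto
    \<comment> \<open>The halves have between \<open>64 * t\<close> and \<open>128 * t\<close>
      elements together and differ by at most \<open>t\<close>, so both \<open>card A0\<close> and
      \<open>m - card A0\<close> are at least \<open>31 * t\<close>.\<close>
    have binom: "2 ^ (31 * t) \<le> m choose card A0"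
      using close cardA A m by (intro power2_le_binomial) auto
    \<comment> \<open>A bad \<open>p\<close> is sorted by the small set \<open>D\<close> in which
      the image of \<open>A0\<close> differs from \<open>A1\<close>; \<open>D\<close> determines
      that image.\<close>
    have "bad \<subseteq> (\<Union>D\<in>{D\<in>\<D>. card (sym_diff D A1) = card A0}. {p. p permutes ?U \<and> p ` A0 = sym_diff D A1})"
    proof
      fix p assume "p \<in> bad"
      then have p: "p permutes ?U" "card (crossing m p A) \<le> t" by (auto simp: bad_def)
      define D where "D = p ` crossing m p A"
      have eq: "sym_diff D A1 = p ` A0" using sub[OF p(1)] unfolding D_def by blast
      have "D \<subseteq> ?U" using permutes_image[OF p(1)] by (auto simp: D_def crossing_def)
      moreover have "card D \<le> t"
        using p(2) card_image_le[of "crossing m p A" p] by (simp add: crossing_def D_def)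
      moreover have "card (sym_diff D A1) = card A0"
        unfolding eq using permutes_inj[OF p(1)] by (meson card_image inj_on_subset subset_UNIV)
      ultimately show "p \<in> (\<Union>D\<in>{D\<in>\<D>. card (sym_diff D A1) = card A0}. {p. p permutes ?U \<and> p ` A0 = sym_diff D A1})"
        using eq p by (intro UN_I[of D]) (auto simp: \<D>_def)
    qed
    then have "card bad \<le> card (\<Union>D\<in>{D\<in>\<D>. card (sym_diff D A1) = card A0}. {p. p permutes ?U \<and> p ` A0 = sym_diff D A1})"
      using fin finite_permutations[of ?U] by (intro card_mono) auto
    also have "\<dots> \<le> (\<Sum>D\<in>{D\<in>\<D>. card (sym_diff D A1) = card A0}. card {p. p permutes ?U \<and> p ` A0 = sym_diff D A1})"
      using fin by (intro card_UN_le) auto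
    finally have "(m choose card A0) * card bad
      \<le> (\<Sum>D\<in>{D\<in>\<D>. card (sym_diff D A1) = card A0}.
          (m choose card A0) * card {p. p permutes ?U \<and> p ` A0 = sym_diff D A1})"
      by (simp add: sum_distrib_left[symmetric])
    also have "\<dots> \<le> (\<Sum>D\<in>{D\<in>\<D>. card (sym_diff D A1) = card A0}. fact m)"
    proof (rule sum_mono)
      fix D assume "D \<in> {D\<in>\<D>. card (sym_diff D A1) = card A0}"
      then show "(m choose card A0) * card {p. p permutes ?U \<and> p ` A0 = sym_diff D A1} \<le> fact m"
        using card_permutes_image_le[of ?U A0 "sym_diff D A1"]
        by (auto simp: \<D>_def A0_def A1_def)
    qed
    also have "\<dots> \<le> card \<D> * fact m"
      using fin by (auto intro!: card_mono)
    finally have "(m choose card A0) * card bad \<le> card \<D> * fact m" .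
    then show ?thesis
      using binom unfolding bad_def \<D>_def by (meson le_trans mult_le_mono1)
  qed
qed

text \<open>Union bound: the number of sets with a small cycle boundary, times the bound on the
  fraction of permutations that are bad for one of them, is below 1.\<close>

lemma ex_mixing_permutation:
  fixes m t :: nat
  assumes m: "m = 128 * t" and t: "t \<ge> 1"
  obtains p where "p permutes {..<m}"
    and "\<And>A. A \<subseteq> {..<2 * m} \<Longrightarrow> m \<le> 2 * card A \<Longrightarrow> card A \<le> m
      \<Longrightarrow> card (cycle_boundary (2 * m) A) \<le> t \<Longrightarrow> t < card (crossing m p A)"
proof -
  let ?U = "{..<m}" and ?V = "{..<2 * m}"
  let ?small = "\<lambda>U. {D. D \<subseteq> U \<and> card D \<le> t}"
  define \<A> where "\<A> = {A. A \<subseteq> ?V \<and> m \<le> 2 * card A \<and> card A \<le> m \<and> card (cycle_boundary (2 * m) A) \<le> t}"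
  define bad where "bad A = {p. p permutes ?U \<and> card (crossing m p A) \<le> t}" for A
  have finA: "finite \<A>" by (rule finite_subset[of _ "Pow ?V"]) (auto simp: \<A>_def)
  \<comment> \<open>The factor \<open>2\<close> records whether \<open>0\<close> belongs to the
    set.\<close>
  have "card \<A> \<le> card ((UNIV :: bool set) \<times> ?small ?V)"
  proof (rule card_inj_on_le)
    show "inj_on (\<lambda>A. (0 \<in> A, cycle_boundary (2 * m) A)) \<A>"
      using inj_on_cycle_boundary by (rule inj_on_subset) (auto simp: \<A>_def)
    show "(\<lambda>A. (0 \<in> A, cycle_boundary (2 * m) A)) ` \<A> \<subseteq> UNIV \<times> ?small ?V"
      by (auto simp: \<A>_def cycle_boundary_def)
  qed simp
  then have cardA: "card \<A> \<le> 2 * card (?small ?V)" by (simp add: card_cartesian_product)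
  \<comment> \<open>With \<open>x = 1/64\<close>, the price \<open>64 ^ t\<close> and the factor
    \<open>(65/64) ^ card U\<close> are both small powers of 2, as \<open>card U\<close> will be at
    most \<open>256 * t\<close>.\<close>
  have small: "real (card (?small U)) \<le> 2 ^ (6 * t) * (65/64) ^ card U" if "finite U" for U :: "nat set"
  proof -
    have "real (card (?small U)) = real (card (?small U)) * (1/64) ^ t * 64 ^ t"
      by (simp add: power_one_over)
    also have "\<dots> \<le> (1 + 1/64) ^ card U * 64 ^ t"
      using that by (intro mult_right_mono card_small_subsets) auto
    also have "(64::real) ^ t = 2 ^ (6 * t)" by (simp add: power_mult)
    finally show ?thesis by (simp add: mult.commute)
  qed
  have "real (card \<A> * card (?small ?U)) \<le> 2 * (2 ^ (6 * t) * (65/64) ^ (2 * m)) * (2 ^ (6 * t) * (65/64) ^ m)"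
    using cardA small[of ?V] small[of ?U]
    by (simp only: of_nat_mult, intro mult_mono) auto
  \<comment> \<open>The exponents of \<open>65/64\<close> add up to
    \<open>3 * m = 64 * 6 * t\<close>. The grouping by 64 serves to bound
    \<open>(65/64) ^ 64\<close> by 3, and \<open>3 ^ 6 \<le> 2 ^ 10\<close>; the total exponent of 2
    is then \<open>(1 + 12 + 10) * t\<close>, short of \<open>31 * t\<close>.\<close>
  also have "\<dots> = 2 * 2 ^ (12 * t) * (((65/64) ^ 64) ^ 6) ^ t"
    by (simp add: m power_mult[symmetric] power_add[symmetric] mult.assoc mult.left_commute)
  also have "\<dots> \<le> 2 ^ t * 2 ^ (12 * t) * (2 ^ 10) ^ t"
  proof -
    have "((65/64) ^ 64) ^ 6 \<le> (3 :: real) ^ 6" by (intro power_mono) (simp_all add: power_divide)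
    also have "\<dots> \<le> 2 ^ 10" by simp
    finally have "(((65/64) ^ 64) ^ 6) ^ t \<le> ((2 :: real) ^ 10) ^ t" by (intro power_mono) auto
    moreover have "(2 :: real) \<le> 2 ^ t" using t self_le_power[of "2::real" t] by simp
    ultimately show ?thesis by (intro mult_mono) auto
  qed
  also have "\<dots> = 2 ^ (23 * t)" by (simp only: power_mult[symmetric] power_add[symmetric]) simp
  also have "\<dots> < 2 ^ (31 * t)" using t by (intro power_strict_increasing) auto
  finally have "real (card \<A> * card (?small ?U)) < real (2 ^ (31 * t))"
    by (simp only: of_nat_power of_nat_numeral)
  then have count: "card \<A> * card (?small ?U) < 2 ^ (31 * t)"
    by (simp only: of_nat_less_iff)
  have "2 ^ (31 * t) * card (\<Union>A\<in>\<A>. bad A) \<le> 2 ^ (31 * t) * (\<Sum>A\<in>\<A>. card (bad A))"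
    using finA by (intro mult_le_mono2 card_UN_le)
  also have "\<dots> = (\<Sum>A\<in>\<A>. 2 ^ (31 * t) * card (bad A))" by (rule sum_distrib_left)
  also have "\<dots> \<le> (\<Sum>A\<in>\<A>. card (?small ?U) * fact m)"
    unfolding bad_def by (intro sum_mono card_few_crossings m) (auto simp: \<A>_def)
  also have "\<dots> = card \<A> * card (?small ?U) * fact m" by simp
  also have "\<dots> < 2 ^ (31 * t) * fact m" using count by (intro mult_strict_right_mono) auto
  finally have "card (\<Union>A\<in>\<A>. bad A) < card {p. p permutes ?U}"
    by (simp add: card_permutations)
  moreover have "finite (\<Union>A\<in>\<A>. bad A)"
    using finA finite_permutations[of ?U] by (simp add: bad_def)
  ultimately have "\<not> {p. p permutes ?U} \<subseteq> (\<Union>A\<in>\<A>. bad A)"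
    using card_mono leD by blast
  then obtain p where p: "p permutes ?U" "p \<notin> (\<Union>A\<in>\<A>. bad A)" by auto
  show thesis
  proof (rule that[OF p(1)])
    fix A assume "A \<subseteq> ?V" "m \<le> 2 * card A" "card A \<le> m" "card (cycle_boundary (2 * m) A) \<le> t"
    then have "A \<in> \<A>" by (simp add: \<A>_def)
    then have "p \<notin> bad A" using p(2) by blast
    then show "t < card (crossing m p A)" using p(1) by (simp add: bad_def)
  qed
qed

section \<open>Components and egg-cuts\<close>

lemma sym_adj: "sym (adj G)"
  by (auto simp: sym_def adj_def insert_commute)

lemma adj_mono: "edges H \<subseteq> edges G \<Longrightarrow> ends H = ends G \<Longrightarrow> adj H \<subseteq> adj G"
  by (auto simp: adj_def)

lemma subgraph_adj: "subgraph H G \<Longrightarrow> adj H \<subseteq> adj G"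
  by (rule adj_mono) (auto simp: subgraph_def)

lemma rtrancl_closed:
  assumes "(u, v) \<in> r\<^sup>*" "u \<in> A" "\<And>x y. (x, y) \<in> r \<Longrightarrow> x \<in> A \<Longrightarrow> y \<in> A"
  shows "v \<in> A"
  using assms by (induction rule: rtrancl_induct) auto

lemma subgraph_refl: "wf_mgraph G \<Longrightarrow> subgraph G G"
  by (simp add: subgraph_def)

lemma subgraph_trans: "subgraph H K \<Longrightarrow> subgraph K G \<Longrightarrow> subgraph H G"
  by (auto simp: subgraph_def)

lemma subgraph_ends: "subgraph H G \<Longrightarrow> e \<in> edges H \<Longrightarrow> ends G e \<subseteq> verts H"
  by (metis subgraph_def wf_mgraph_def)

lemma finite_subgraphs:
  fixes G :: "('v, 'e) mgraph"
  assumes "wf_mgraph G"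
  shows "finite {H :: ('v, 'e) mgraph. subgraph H G}"
proof (rule finite_subset)
  show "{H :: ('v, 'e) mgraph. subgraph H G}
    \<subseteq> (\<lambda>(V, E). \<lparr>verts = V, edges = E, ends = ends G\<rparr>) ` (Pow (verts G) \<times> Pow (edges G))"
  proof
    fix H :: "('v, 'e) mgraph"
    assume "H \<in> {H. subgraph H G}"
    then show "H \<in> (\<lambda>(V, E). \<lparr>verts = V, edges = E, ends = ends G\<rparr>) ` (Pow (verts G) \<times> Pow (edges G))"
      by (intro image_eqI[of _ _ "(verts H, edges H)"]) (auto simp: subgraph_def)
  qed
qed (use assms in \<open>auto simp: wf_mgraph_def\<close>)

lemma connected_mgraphI:
  assumes "v \<in> verts G" "\<And>w. w \<in> verts G \<Longrightarrow> (v, w) \<in> (adj G)\<^sup>*"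
  shows "connected_mgraph G"
  unfolding connected_mgraph_def
proof (intro conjI ballI)
  fix u w assume "u \<in> verts G" "w \<in> verts G"
  with assms have "(v, u) \<in> (adj G)\<^sup>*" "(v, w) \<in> (adj G)\<^sup>*" by auto
  then show "(u, w) \<in> (adj G)\<^sup>*"
    using symD[OF sym_rtrancl[OF sym_adj]] rtrancl_trans by fast
qed (use assms in auto)

text \<open>The union of two connected subgraphs with a common vertex is connected, so by maximality
  it equals both.\<close>

lemma components_eqI:
  fixes G :: "('v, 'e) mgraph"
  assumes C: "C\<^sub>1 \<in> components G" "C\<^sub>2 \<in> components G"
    and v: "v \<in> verts C\<^sub>1" "v \<in> verts C\<^sub>2"
  shows "C\<^sub>1 = C\<^sub>2"
proof -
  define D :: "('v, 'e) mgraph" where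
    "D = \<lparr>verts = verts C\<^sub>1 \<union> verts C\<^sub>2, edges = edges C\<^sub>1 \<union> edges C\<^sub>2, ends = ends G\<rparr>"
  have sub: "subgraph C\<^sub>1 G" "subgraph C\<^sub>2 G"
    and con: "connected_mgraph C\<^sub>1" "connected_mgraph C\<^sub>2"
    using C by (auto simp: components_def)
  have "ends G e \<subseteq> verts D" if "e \<in> edges D" for e
    using that sub[THEN subgraph_ends] by (auto simp: D_def)
  moreover have "card (ends G e) = 2" if "e \<in> edges D" for e
    using that sub by (auto simp: D_def subgraph_def wf_mgraph_def)
  ultimately have "subgraph D G"
    using sub by (simp add: D_def subgraph_def wf_mgraph_def)
  moreover from this have "subgraph C\<^sub>1 D" "subgraph C\<^sub>2 D"
    using sub by (auto simp: D_def subgraph_def)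
  ultimately have D: "subgraph D G" "subgraph C\<^sub>1 D" "subgraph C\<^sub>2 D" by auto
  have "connected_mgraph D"
  proof (rule connected_mgraphI)
    show "v \<in> verts D" using v by (simp add: D_def)
    fix w assume "w \<in> verts D"
    then have "(v, w) \<in> (adj C\<^sub>1)\<^sup>* \<union> (adj C\<^sub>2)\<^sup>*"
      using v con by (auto simp: D_def connected_mgraph_def)
    then show "(v, w) \<in> (adj D)\<^sup>*"
      using rtrancl_mono[OF subgraph_adj[OF D(2)]] rtrancl_mono[OF subgraph_adj[OF D(3)]] by auto
  qed
  then have "D = C\<^sub>1" "D = C\<^sub>2"
    using C D by (auto simp: components_def)
  then show ?thesis by simp
qed

text \<open>Among the connected subgraphs that contain \<open>E\<close>, one with the most vertices
  and edges together is maximal.\<close>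

lemma ex_component:
  fixes G :: "('v, 'e) mgraph"
  assumes G: "wf_mgraph G" and E: "subgraph E G" "connected_mgraph E"
  obtains C where "C \<in> components G" "subgraph E C"
proof -
  define P :: "('v, 'e) mgraph \<Rightarrow> bool" where
    "P D \<longleftrightarrow> subgraph D G \<and> connected_mgraph D \<and> subgraph E D" for D
  let ?f = "\<lambda>D :: ('v, 'e) mgraph. card (verts D) + card (edges D)"
  have "P E" using E by (auto simp: P_def subgraph_def)
  moreover have "\<forall>D. P D \<longrightarrow> ?f D < Suc (card (verts G) + card (edges G))"
    using G by (simp add: P_def subgraph_def wf_mgraph_def add_mono card_mono less_Suc_eq_le)
  ultimately obtain C where "P C" and max: "\<And>D. P D \<Longrightarrow> ?f D \<le> ?f C"
    using ex_has_greatest_nat[of P E ?f "Suc (card (verts G) + card (edges G))"] by blast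
  then have C: "subgraph C G" "connected_mgraph C" "subgraph E C" by (simp_all add: P_def)
  have "D = C" if D: "subgraph D G" "connected_mgraph D" "subgraph C D" for D
  proof -
    have le: "?f D \<le> ?f C" using D C by (intro max) (auto simp: P_def intro: subgraph_trans)
    have sub: "verts C \<subseteq> verts D" "edges C \<subseteq> edges D" "ends C = ends D"
      and fin: "finite (verts D)" "finite (edges D)"
      using D by (auto simp: subgraph_def wf_mgraph_def)
    have "card (verts C) \<le> card (verts D)" "card (edges C) \<le> card (edges D)"
      using sub fin by (auto intro: card_mono)
    with le have "card (verts C) = card (verts D)" "card (edges C) = card (edges D)" by auto
    then have "verts C = verts D" "edges C = edges D"
      using sub fin by (simp_all add: card_subset_eq)
    with sub(3) show ?thesis by simp
  qed
  with C have "C \<in> components G" by (auto simp: components_def)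
  with C show thesis using that by blast
qed

section \<open>Edge boundaries and egg-cuts\<close>

definition boundary :: "('v, 'e) mgraph \<Rightarrow> 'v set \<Rightarrow> 'e set" where
  "boundary G A = {e \<in> edges G. ends G e \<inter> A \<noteq> {} \<and> \<not> ends G e \<subseteq> A}"

lemma card_incident_le:
  assumes "regular d G" "finite (edges G)" "X \<subseteq> verts G" "finite X"
  shows "card {e \<in> edges G. ends G e \<inter> X \<noteq> {}} \<le> d * card X"
proof -
  have "{e \<in> edges G. ends G e \<inter> X \<noteq> {}} = (\<Union>v\<in>X. {e \<in> edges G. v \<in> ends G e})" by auto
  then have "card {e \<in> edges G. ends G e \<inter> X \<noteq> {}} \<le> (\<Sum>v\<in>X. card {e \<in> edges G. v \<in> ends G e})"
    using assms(4) by (simp add: card_UN_le)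
  also have "\<dots> = (\<Sum>v\<in>X. d)"
    using assms by (intro sum.cong) (auto simp: regular_def degree_def)
  finally show ?thesis by (simp add: mult.commute)
qed

lemma card_boundary_le:
  assumes "regular d G" "finite (edges G)" "A \<subseteq> verts G" "finite A"
  shows "card (boundary G A) \<le> d * card A"
proof -
  have "card (boundary G A) \<le> card {e \<in> edges G. ends G e \<inter> A \<noteq> {}}"
    using assms by (intro card_mono) (auto simp: boundary_def)
  with card_incident_le[OF assms] show ?thesis by simp
qed

text \<open>Neither egg has an edge in the boundary, so both survive the deletion, while no
  remaining edge leaves \<open>verts E\<close>. Hence they lie in different components.\<close>

lemma egg_cut_boundary:
  fixes G :: "('v, 'e) mgraph"
  assumes G: "wf_mgraph G" and S: "scramble G S"
    and E: "E \<in> S" "E' \<in> S" "verts E \<inter> verts E' = {}"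
  shows "egg_cut G S (boundary G (verts E))"
proof -
  let ?F = "boundary G (verts E)"
  let ?H = "delete_edges G ?F"
  have sub: "subgraph E G" "subgraph E' G" and con: "connected_mgraph E" "connected_mgraph E'"
    using S E by (auto simp: scramble_def)
  have H: "wf_mgraph ?H" using G by (auto simp: delete_edges_def wf_mgraph_def)
  have "edges E \<inter> ?F = {}"
    using subgraph_ends[OF sub(1)] by (auto simp: boundary_def)
  then have "subgraph E ?H"
    using sub by (auto simp: subgraph_def delete_edges_def)
  then obtain C where C: "C \<in> components ?H" "subgraph E C"
    using ex_component[OF H _ con(1)] by blast
  have "edges E' \<inter> ?F = {}"
    using subgraph_ends[OF sub(2)] E(3) unfolding boundary_def by blast
  then have "subgraph E' ?H"
    using sub by (auto simp: subgraph_def delete_edges_def)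
  then obtain C' where C': "C' \<in> components ?H" "subgraph E' C'"
    using ex_component[OF H _ con(2)] by blast
  have subC: "subgraph C ?H" and conC: "connected_mgraph C" using C by (auto simp: components_def)
  have "C \<noteq> C'"
  proof
    assume eq: "C = C'"
    obtain u v where uv: "u \<in> verts E" "v \<in> verts E'" using con by (auto simp: connected_mgraph_def)
    moreover have "verts E \<subseteq> verts C" "verts E' \<subseteq> verts C"
      using C C' eq by (auto simp: subgraph_def)
    ultimately have "(u, v) \<in> (adj C)\<^sup>*"
      using conC unfolding connected_mgraph_def by blast
    then have "v \<in> verts E" using uv(1)
    proof (rule rtrancl_closed)
      fix x y assume xy: "(x, y) \<in> adj C" "x \<in> verts E"
      then obtain e where "e \<in> edges G" "e \<notin> ?F" "ends G e = {x, y}"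
        using subC by (auto simp: subgraph_def delete_edges_def adj_def)
      with xy show "y \<in> verts E" by (auto simp: boundary_def)
    qed
    with uv E show False by auto
  qed
  moreover have "?F \<subseteq> edges G" by (auto simp: boundary_def)
  ultimately show ?thesis using C C' E unfolding egg_cut_def by blast
qed

lemma components_disjoint:
  "C\<^sub>1 \<in> components G \<Longrightarrow> C\<^sub>2 \<in> components G \<Longrightarrow> C\<^sub>1 \<noteq> C\<^sub>2
    \<Longrightarrow> verts C\<^sub>1 \<inter> verts C\<^sub>2 = {}"
  using components_eqI by fast

lemma subgraph_vertsD: "subgraph H G \<Longrightarrow> verts H \<subseteq> verts G"
  by (simp add: subgraph_def)

text \<open>Different components have no common vertex. A scramble whose eggs meet pairwise
  therefore has no egg-cut.\<close>

lemma egg_cutD: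
  "egg_cut G S F \<Longrightarrow> \<exists>E\<in>S. \<exists>E'\<in>S. verts E \<inter> verts E' = {}"
  unfolding egg_cut_def by (meson components_disjoint subgraph_vertsD disjoint_iff subsetD)

section \<open>Attainment of the hitting, scramble and carton numbers\<close>

lemma finite_hitting_set_cards:
  "wf_mgraph G \<Longrightarrow> finite {card X |X. hitting_set G S X}"
  by (rule finite_subset[of _ "card ` Pow (verts G)"]) (auto simp: hitting_set_def wf_mgraph_def)

lemma hitting_number_le:
  "wf_mgraph G \<Longrightarrow> hitting_set G S X \<Longrightarrow> hitting_number G S \<le> card X"
  unfolding hitting_number_def by (intro Min_le finite_hitting_set_cards) auto

lemma hitting_set_verts: "scramble G S \<Longrightarrow> hitting_set G S (verts G)"
  by (fastforce simp: hitting_set_def scramble_def subgraph_def connected_mgraph_def)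

lemma hitting_number_attained:
  assumes "wf_mgraph G" "scramble G S"
  obtains X where "hitting_set G S X" "card X = hitting_number G S"
proof -
  have "hitting_number G S \<in> {card X |X. hitting_set G S X}"
    unfolding hitting_number_def
    using hitting_set_verts[OF assms(2)] by (intro Min_in finite_hitting_set_cards assms) auto
  then show thesis using that by force
qed

lemma scramble_order_le:
  assumes "wf_mgraph G" "scramble G S"
  shows "scramble_order G S \<le> enat (card (verts G))"
  using hitting_number_le[OF assms(1) hitting_set_verts[OF assms(2)]]
  unfolding scramble_order_def by (simp add: min.coboundedI1)

lemma finite_scramble_orders:
  "wf_mgraph G \<Longrightarrow> finite {k. \<exists>S. scramble G S \<and> scramble_order G S = enat k}"
  by (rule finite_subset[of _ "{..card (verts G)}"]) (auto dest: scramble_order_le)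

lemma le_sn:
  "wf_mgraph G \<Longrightarrow> scramble G S \<Longrightarrow> scramble_order G S = enat k \<Longrightarrow> k \<le> sn G"
  unfolding sn_def by (intro Max_ge finite_scramble_orders) auto

lemma sn_attained:
  fixes G :: "('v, 'e) mgraph"
  assumes "graph G"
  obtains S where "scramble G S" "scramble_order G S = enat (sn G)"
proof -
  have wf: "wf_mgraph G" using assms by (simp add: graph_def)
  \<comment> \<open>This scramble shows that the maximum is taken over a nonempty set.\<close>
  have "scramble G {G}" using assms by (simp add: scramble_def graph_def subgraph_refl)
  moreover then obtain k where "scramble_order G {G} = enat k"
    using scramble_order_le[OF wf] by (metis enat_ile)
  ultimately have "sn G \<in> {k. \<exists>S. scramble G S \<and> scramble_order G S = enat k}"
    unfolding sn_def by (intro Max_in finite_scramble_orders wf) auto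
  then show thesis using that by auto
qed

text \<open>A graph has finitely many subgraphs. So every scramble is finite, its
  \<open>card\<close> is its true size, and the minimum is attained.\<close>

lemma cart_attained:
  fixes G :: "('v, 'e) mgraph"
  assumes "graph G"
  obtains S where "scramble G S" "scramble_order G S = enat (sn G)" "card S = cart G" "finite S"
proof -
  have wf: "wf_mgraph G" using assms by (simp add: graph_def)
  let ?H = "{H :: ('v, 'e) mgraph. subgraph H G}"
  have sub: "S \<subseteq> ?H" if "scramble G S" for S using that by (auto simp: scramble_def)
  have "{card S |S. scramble G S \<and> scramble_order G S = enat (sn G)} \<subseteq> card ` Pow ?H"
    using sub by blast
  then have "finite {card S |S. scramble G S \<and> scramble_order G S = enat (sn G)}"
    by (rule finite_subset) (simp add: finite_subgraphs[OF wf])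
  then have "cart G \<in> {card S |S. scramble G S \<and> scramble_order G S = enat (sn G)}"
    unfolding cart_def using sn_attained[OF assms] by (intro Min_in) auto
  then show thesis using that sub finite_subset[OF _ finite_subgraphs[OF wf]] by force
qed

section \<open>Bounds for the carton number and the scramble number\<close>

text \<open>A small egg is either a small hitting set or separated from a disjoint egg by a small cut.\<close>

lemma scramble_order_le_card_egg:
  assumes G: "wf_mgraph G" "regular d G" "d \<ge> 1"
    and S: "scramble G S" "E \<in> S" "enat s \<le> scramble_order G S"
  shows "s \<le> d * card (verts E)"
proof (rule ccontr)
  assume small: "\<not> s \<le> d * card (verts E)"
  have sub: "verts E \<subseteq> verts G" "finite (verts E)" "finite (edges G)"
    using S G by (auto simp: scramble_def subgraph_def wf_mgraph_def)
  have s: "s \<le> hitting_number G S" "enat s \<le> egg_cut_number G S"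
    using S(3) by (simp_all add: scramble_order_def)
  \<comment> \<open>As \<open>d \<ge> 1\<close>, the egg has fewer than \<open>s\<close> vertices,
    too few for a hitting set.\<close>
  have "card (verts E) \<le> d * card (verts E)" using G(3) by simp
  then have "\<not> hitting_set G S (verts E)"
    using hitting_number_le[OF G(1), of S "verts E"] s(1) small by linarith
  then obtain E' where E': "E' \<in> S" "verts E \<inter> verts E' = {}"
    using sub by (auto simp: hitting_set_def)
  then have "egg_cut G S (boundary G (verts E))" using egg_cut_boundary G S by blast
  then have "egg_cut_number G S \<le> enat (card (boundary G (verts E)))"
    unfolding egg_cut_number_def by (intro Inf_lower) auto
  with s(2) have "s \<le> card (boundary G (verts E))" by (metis enat_ord_simps(1) order_trans)
  also have "\<dots> \<le> d * card (verts E)" using card_boundary_le G sub by blast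
  finally show False using small by simp
qed

text \<open>By averaging, some vertex lies in at least a fraction \<open>\<gamma>\<close> of the
  sets not yet hit. Adding it multiplies their number by at most
  \<open>1 - \<gamma>\<close>.\<close>

lemma greedy_hitting_set:
  fixes \<gamma> :: real
  assumes V: "finite V" "V \<noteq> {}" and "finite S" and \<gamma>: "\<gamma> \<le> 1"
    and F: "\<And>E. E \<in> S \<Longrightarrow> F E \<subseteq> V" "\<And>E. E \<in> S \<Longrightarrow> \<gamma> * card V \<le> card (F E)"
  shows "\<exists>X\<subseteq>V. card X \<le> k \<and> card {E \<in> S. X \<inter> F E = {}} \<le> (1 - \<gamma>) ^ k * card S"
proof (induction k)
  case 0
  show ?case by (rule exI[of _ "{}"]) simp
next
  case (Suc k)
  then obtain X where X: "X \<subseteq> V" "card X \<le> k"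
    and R: "card {E \<in> S. X \<inter> F E = {}} \<le> (1 - \<gamma>) ^ k * card S" by blast
  define R where "R = {E \<in> S. X \<inter> F E = {}}"
  have finR: "finite R" using assms by (simp add: R_def)
  \<comment> \<open>Otherwise double counting of the pairs of a vertex and a set in \<open>R\<close>
    that contains it gives fewer than \<open>\<gamma> * card V * card R\<close> pairs from the
    vertices, but at least as many from the sets.\<close>
  have "\<exists>v\<in>V. \<gamma> * card R \<le> card {E \<in> R. v \<in> F E}"
  proof (rule ccontr)
    assume "\<not> ?thesis"
    then have "(\<Sum>v\<in>V. real (card {E \<in> R. v \<in> F E})) < (\<Sum>v\<in>V. \<gamma> * card R)"
      using V by (intro sum_strict_mono) auto
    also have "\<dots> = (\<Sum>E\<in>R. \<gamma> * card V)" by simp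
    also have "\<dots> \<le> (\<Sum>E\<in>R. real (card (F E)))"
      using F(2) by (intro sum_mono) (auto simp: R_def)
    also have "\<dots> = (\<Sum>E\<in>R. real (card {v \<in> V. v \<in> F E}))"
      using F(1) by (intro sum.cong refl arg_cong[of _ _ "\<lambda>A. real (card A)"]) (auto simp: R_def)
    also have "\<dots> = (\<Sum>v\<in>V. real (card {E \<in> R. v \<in> F E}))"
      using sum_multicount_gen[of R V "\<lambda>E v. v \<in> F E" "\<lambda>v. card {E \<in> R. v \<in> F E}"] finR V
      by (simp flip: of_nat_sum)
    finally show False by simp
  qed
  then obtain v where v: "v \<in> V" "\<gamma> * card R \<le> card {E \<in> R. v \<in> F E}" by blast
  have "{E \<in> S. insert v X \<inter> F E = {}} = R - {E \<in> R. v \<in> F E}" by (auto simp: R_def)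
  then have "real (card {E \<in> S. insert v X \<inter> F E = {}}) = card R - card {E \<in> R. v \<in> F E}"
    using finR by (simp add: card_Diff_subset of_nat_diff card_mono)
  also have "\<dots> \<le> (1 - \<gamma>) * card R" using v finR by (simp add: algebra_simps of_nat_diff card_mono)
  also have "\<dots> \<le> (1 - \<gamma>) * ((1 - \<gamma>) ^ k * card S)"
    using R \<gamma> by (intro mult_left_mono) (auto simp: R_def)
  finally have "real (card {E \<in> S. insert v X \<inter> F E = {}}) \<le> (1 - \<gamma>) ^ Suc k * card S" by simp
  moreover have "card (insert v X) \<le> Suc k"
    using X V finite_subset[of X V] by (simp add: card_insert_if)
  ultimately show ?case using v X by (intro exI[of _ "insert v X"]) auto
qed

text \<open>Fewer than \<open>sn G\<close> vertices miss some egg. After \<open>k\<close> greedy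
  choices at least one egg thus remains, which gives
  \<open>1 \<le> (1 - \<gamma>) ^ k * card S\<close>.\<close>

theorem cart_lower_bound:
  assumes G: "graph G" "regular d G" "d \<ge> 1" and k: "k < sn G"
  shows "2 powr (real k ^ 2 / (d * card (verts G))) \<le> cart G"
proof -
  have wf: "wf_mgraph G" and V: "finite (verts G)" "verts G \<noteq> {}"
    using G by (auto simp: graph_def wf_mgraph_def connected_mgraph_def)
  then have n: "card (verts G) > 0" by auto
  obtain S where S: "scramble G S" "scramble_order G S = enat (sn G)" "card S = cart G" "finite S"
    using cart_attained[OF G(1)] .
  \<comment> \<open>Each egg has at least \<open>sn G / d\<close>, hence more than
    \<open>k / d\<close> vertices; \<open>\<gamma>\<close> is this number as a fraction of all
    vertices.\<close>
  define \<gamma> where "\<gamma> = real k / (d * card (verts G))"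
  have egg: "\<gamma> * card (verts G) \<le> card (verts E)" if "E \<in> S" for E
  proof -
    have "sn G \<le> d * card (verts E)"
      using scramble_order_le_card_egg[OF wf G(2,3) S(1) that] S(2) by simp
    with k have "real k \<le> d * card (verts E)" by (simp flip: of_nat_mult)
    then show ?thesis using G(3) n by (simp add: \<gamma>_def field_simps)
  qed
  have sub: "verts E \<subseteq> verts G" if "E \<in> S" for E
    using S that by (auto simp: scramble_def subgraph_def)
  obtain E where "E \<in> S" using S by (auto simp: scramble_def)
  then have "\<gamma> * card (verts G) \<le> card (verts G)"
    using egg[of E] sub[of E] card_mono[OF V(1), of "verts E"] by simp
  then have \<gamma>: "\<gamma> \<le> 1" using n by simp
  obtain X where X: "X \<subseteq> verts G" "card X \<le> k"
    and unhit: "card {E \<in> S. X \<inter> verts E = {}} \<le> (1 - \<gamma>) ^ k * card S"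
    using greedy_hitting_set[of "verts G" S \<gamma> verts k] V S \<gamma> sub egg by blast
  have "\<not> hitting_set G S X"
  proof
    assume "hitting_set G S X"
    then have "hitting_number G S \<le> k" using hitting_number_le[OF wf, of S X] X(2) by linarith
    moreover have "sn G \<le> hitting_number G S"
      using S(2) by (metis enat_ord_simps(1) min.cobounded1 scramble_order_def)
    ultimately show False using k by simp
  qed
  then have "{E \<in> S. X \<inter> verts E = {}} \<noteq> {}" using X by (auto simp: hitting_set_def)
  then have "1 \<le> card {E \<in> S. X \<inter> verts E = {}}"
    using S(4) by (simp add: Suc_le_eq card_gt_0_iff)
  then have "1 \<le> (1 - \<gamma>) ^ k * card S" using unhit by linarith
  also have "\<dots> \<le> exp (- \<gamma>) ^ k * card S"
    using \<gamma> exp_ge_add_one_self[of "- \<gamma>"] by (intro mult_right_mono power_mono) auto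
  also have "\<dots> = card S / exp (\<gamma> * k)"
    by (simp add: exp_minus exp_of_nat2_mult[symmetric] field_simps power_inverse)
  finally have "exp (\<gamma> * k) \<le> card S" by (simp add: field_simps)
  moreover have "2 powr (\<gamma> * k) \<le> exp (\<gamma> * k)"
  proof -
    have "ln 2 \<le> (1 :: real)" using ln_le_minus_one[of "2::real"] by simp
    then show ?thesis using mult_left_mono[of "ln 2" 1 "\<gamma> * k"] by (simp add: powr_def \<gamma>_def)
  qed
  ultimately show ?thesis using S(3) by (simp add: \<gamma>_def power2_eq_square)
qed

text \<open>The scramble of all connected subgraphs on more than half of the vertices has no egg-cut. If
  \<open>X\<close> hits all of its eggs, a largest union of components of \<open>G - X\<close> with at most half of the
  vertices has at least a quarter of them, and only edges at \<open>X\<close> leave it.\<close>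

theorem sn_lower_bound:
  fixes G :: "('v, 'e) mgraph"
  assumes G: "graph G" "regular d G" and k: "4 * k \<le> card (verts G)"
    and expand: "\<And>A. A \<subseteq> verts G \<Longrightarrow> card (verts G) \<le> 4 * card A \<Longrightarrow> 2 * card A \<le> card (verts G)
      \<Longrightarrow> d * k < card (boundary G A)"
  shows "k < sn G"
proof -
  let ?V = "verts G"
  have wf: "wf_mgraph G" and V: "finite ?V" "?V \<noteq> {}" "finite (edges G)"
    using G by (auto simp: graph_def wf_mgraph_def connected_mgraph_def)
  have adjV: "u \<in> ?V \<and> v \<in> ?V" if "(u, v) \<in> adj G" for u v
    using that wf by (fastforce simp: adj_def wf_mgraph_def)
  define S :: "('v, 'e) mgraph set" where
    "S = {E. subgraph E G \<and> connected_mgraph E \<and> card ?V < 2 * card (verts E)}"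
  have "G \<in> S" using G V by (auto simp: S_def graph_def subgraph_refl card_gt_0_iff)
  then have S: "scramble G S" by (auto simp: scramble_def S_def)
  have "verts E \<inter> verts E' \<noteq> {}" if E: "E \<in> S" "E' \<in> S" for E E'
  proof
    assume disj: "verts E \<inter> verts E' = {}"
    have sub: "verts E \<subseteq> ?V" "verts E' \<subseteq> ?V" using E by (auto simp: S_def subgraph_def)
    then have "card (verts E) + card (verts E') = card (verts E \<union> verts E')"
      using V disj by (metis card_Un_disjoint finite_subset)
    also have "\<dots> \<le> card ?V" using sub V by (intro card_mono) auto
    finally show False using E by (simp add: S_def)
  qed
  then have "\<not> egg_cut G S F" for F using egg_cutD by blast
  then have "egg_cut_number G S = \<infinity>" by (simp add: egg_cut_number_def top_enat_def)
  then have "scramble_order G S = enat (hitting_number G S)" by (simp add: scramble_order_def)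
  then have le: "hitting_number G S \<le> sn G" using le_sn[OF wf S] by blast
  obtain X where X: "hitting_set G S X" "card X = hitting_number G S"
    using hitting_number_attained[OF wf S] .
  then have XV: "X \<subseteq> ?V" by (simp add: hitting_set_def)
  then have finX: "finite X" using V finite_subset by blast
  have "\<not> card X \<le> k"
  proof
    assume Xk: "card X \<le> k"
    define r where "r = adj G \<inter> (?V - X) \<times> (?V - X)"
    \<comment> \<open>Closed under \<open>r\<close>, the adjacency of \<open>G - X\<close>, the set
      \<open>A\<close> is a union of components of \<open>G - X\<close>.\<close>
    define P where "P A \<longleftrightarrow> A \<subseteq> ?V - X \<and> r `` A \<subseteq> A \<and> 2 * card A \<le> card ?V" for A
    have "P {}" by (simp add: P_def)
    moreover have "\<forall>A. P A \<longrightarrow> card A < Suc (card ?V)" by (auto simp: P_def)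
    ultimately obtain A where "P A" and max: "\<And>B. P B \<Longrightarrow> card B \<le> card A"
      using ex_has_greatest_nat[of P "{}" card "Suc (card ?V)"] by blast
    then have A: "A \<subseteq> ?V - X" "r `` A \<subseteq> A" "2 * card A \<le> card ?V" by (simp_all add: P_def)
    have finA: "finite A" using A V finite_subset by (metis finite_Diff)
    have "boundary G A \<subseteq> {e \<in> edges G. ends G e \<inter> X \<noteq> {}}"
    proof
      fix e assume e: "e \<in> boundary G A"
      then have e': "e \<in> edges G" "card (ends G e) = 2" using wf by (auto simp: boundary_def wf_mgraph_def)
      obtain x y where xy: "x \<in> ends G e" "x \<in> A" "y \<in> ends G e" "y \<notin> A"
        using e by (auto simp: boundary_def)
      then have "ends G e = {x, y}" using e'(2) by (auto simp: card_2_iff)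
      then have xy_adj: "(x, y) \<in> adj G" using e' by (auto simp: adj_def)
      have "y \<in> X"
      proof (rule ccontr)
        assume "y \<notin> X"
        then have "(x, y) \<in> r" using xy_adj adjV[OF xy_adj] xy A by (auto simp: r_def)
        with xy A show False by blast
      qed
      with xy e' show "e \<in> {e \<in> edges G. ends G e \<inter> X \<noteq> {}}" by auto
    qed
    then have "card (boundary G A) \<le> card {e \<in> edges G. ends G e \<inter> X \<noteq> {}}"
      using V by (intro card_mono) auto
    also have "\<dots> \<le> d * card X" using card_incident_le G V XV finX by blast
    also have "\<dots> \<le> d * k" using Xk by simp
    finally have "\<not> d * k < card (boundary G A)" by simp
    moreover have "A \<subseteq> ?V" using A(1) by blast
    \<comment> \<open>Only a set of fewer than a quarter of the vertices may have so small a
      boundary.\<close>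
    ultimately have small: "4 * card A < card ?V" using expand[of A] A(3) not_le by blast
    have "card (A \<union> X) < card ?V" using card_Un_le[of A X] small Xk k by linarith
    then have "\<not> ?V \<subseteq> A \<union> X" using card_mono[of "A \<union> X" ?V] finA finX by auto
    then obtain v where v: "v \<in> ?V" "v \<notin> A" "v \<notin> X" by blast
    \<comment> \<open>The component of \<open>v\<close> in \<open>G - X\<close>. It is disjoint from
      \<open>A\<close>, because \<open>A\<close> is closed under the symmetric relation
      \<open>r\<close>.\<close>
    define C where "C = r\<^sup>* `` {v}"
    have symr: "sym r" using sym_adj[of G] by (auto simp: r_def sym_def)
    have rC: "r `` C \<subseteq> C" by (auto simp: C_def intro: rtrancl_into_rtrancl)
    have "C \<subseteq> ?V - X - A"
    proof
      fix w assume "w \<in> C"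
      then have "(v, w) \<in> r\<^sup>*" by (simp add: C_def)
      then show "w \<in> ?V - X - A"
      proof (rule rtrancl_closed)
        fix x y assume xy: "(x, y) \<in> r" "x \<in> ?V - X - A"
        then have "(y, x) \<in> r" using symr by (auto dest: symD)
        with xy A show "y \<in> ?V - X - A" by (auto simp: r_def)
      qed (use v in auto)
    qed
    then have CV: "C \<subseteq> ?V - X" "A \<inter> C = {}" and finC: "finite C"
      using V by (auto intro: finite_subset)
    have vC: "v \<in> C" by (simp add: C_def)
    have "2 * card C \<le> card ?V"
    proof (rule ccontr)
      assume big: "\<not> 2 * card C \<le> card ?V"
      \<comment> \<open>With more than half of the vertices, the subgraph induced by
        \<open>C\<close> would be an egg that \<open>X\<close> misses.\<close>
      define H :: "('v, 'e) mgraph" where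
        "H = \<lparr>verts = C, edges = {e \<in> edges G. ends G e \<subseteq> C}, ends = ends G\<rparr>"
      have "subgraph H G" using wf CV finC by (auto simp: H_def subgraph_def wf_mgraph_def)
      moreover have "connected_mgraph H"
      proof (rule connected_mgraphI)
        show "v \<in> verts H" using vC by (simp add: H_def)
        fix w assume "w \<in> verts H"
        then have "(v, w) \<in> r\<^sup>*" by (simp add: H_def C_def)
        then show "(v, w) \<in> (adj H)\<^sup>*"
        proof (induction rule: rtrancl_induct)
          case (step x y)
          then have "x \<in> C" "y \<in> C" by (auto simp: C_def)
          with step have "(x, y) \<in> adj H" by (auto simp: r_def adj_def H_def)
          with step.IH show ?case by (rule rtrancl_into_rtrancl)
        qed simp
      qed
      ultimately have "H \<in> S" using big by (simp add: S_def H_def)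
      then have "X \<inter> verts H \<noteq> {}" using X(1) by (auto simp: hitting_set_def)
      with CV show False by (auto simp: H_def)
    qed
    then have "card C \<le> card A" using CV rC by (intro max) (auto simp: P_def)
    have card_Un: "card (A \<union> C) = card A + card C"
      using CV finA finC by (simp add: card_Un_disjoint)
    \<comment> \<open>Maximality of \<open>A\<close> bounds \<open>C\<close> by \<open>A\<close>, so
      together they still have less than half of the vertices; this contradicts maximality.\<close>
    have "P (A \<union> C)"
      using A CV rC small \<open>card C \<le> card A\<close> unfolding P_def card_Un by (auto simp: Image_Un)
    then have "card (A \<union> C) \<le> card A" by (rule max)
    with card_Un vC finC show False by auto
  qed
  with X le show ?thesis by simp
qed

section \<open>The family of graphs\<close>

text \<open>The cycle edges are those below \<open>2 * m\<close>; every further block of \<open>m\<close> edges is a copy of the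
  matching between the two halves that \<open>p\<close> describes.\<close>

definition cycle_matching :: "nat \<Rightarrow> nat \<Rightarrow> (nat \<Rightarrow> nat) \<Rightarrow> (nat, nat) mgraph" where
  "cycle_matching d m p = \<lparr>verts = {..<2 * m}, edges = {..<d * m},
     ends = (\<lambda>e. if e < 2 * m then {e, Suc e mod (2 * m)} else {e mod m, m + p (e mod m)})\<rparr>"

lemma Suc_mod_neq: "e < n \<Longrightarrow> 2 \<le> n \<Longrightarrow> Suc e mod n \<noteq> (e :: nat)"
  by (cases "Suc e = n") auto

lemma graph_cycle_matching:
  assumes d: "d \<ge> 3" and m: "m \<ge> 1" and p: "p permutes {..<m}"
  shows "graph (cycle_matching d m p)"
proof -
  let ?G = "cycle_matching d m p"
  have p_less: "p (e mod m) < m" for e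
    using permutes_in_image[OF p, of "e mod m"] m by simp
  have "card {e, Suc e mod (2 * m)} = 2" if "e < 2 * m" for e
    using Suc_mod_neq[OF that] m by (auto simp: card_2_iff)
  moreover have "card {e mod m, m + p (e mod m)} = 2" for e
  proof -
    have "e mod m < m" using m by simp
    then show ?thesis by (auto simp: card_2_iff)
  qed
  moreover have "e mod m < 2 * m" for e
    using mod_less_divisor[of m e] m by linarith
  ultimately have "wf_mgraph ?G"
    using m p_less by (auto simp: wf_mgraph_def cycle_matching_def mult_2)
  moreover have "connected_mgraph ?G"
  proof (rule connected_mgraphI)
    show "0 \<in> verts ?G" using m by (simp add: cycle_matching_def)
    fix w assume "w \<in> verts ?G"
    then have "w < 2 * m" by (simp add: cycle_matching_def)
    then show "(0, w) \<in> (adj ?G)\<^sup>*"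
    proof (induction w)
      case (Suc w)
      have "2 * m \<le> d * m" using d by simp
      then have "w < d * m" using Suc.prems by linarith
      then have "(w, Suc w) \<in> adj ?G"
        using Suc.prems by (auto simp: adj_def cycle_matching_def intro!: bexI[of _ w])
      moreover have "(0, w) \<in> (adj ?G)\<^sup>*" using Suc by simp
      ultimately show ?case by (simp add: rtrancl_into_rtrancl)
    qed simp
  qed
  ultimately show ?thesis by (simp add: graph_def)
qed

text \<open>Each vertex has two cycle edges, \<open>C\<close>, and one edge in each of the
  \<open>d - 2\<close> copies of the matching, \<open>M\<close>. Edges are counted by number, so
  parallel edges count separately.\<close>

lemma regular_cycle_matching:
  assumes d: "d \<ge> 3" and m: "m \<ge> 1" and p: "p permutes {..<m}"
  shows "regular d (cycle_matching d m p)"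
  unfolding regular_def
proof
  let ?G = "cycle_matching d m p"
  fix v assume "v \<in> verts ?G"
  then have v: "v < 2 * m" by (simp add: cycle_matching_def)
  have dm: "2 * m \<le> d * m" using d by simp
  define C where "C = {e. e < 2 * m \<and> (v = e \<or> v = Suc e mod (2 * m))}"
  define u where "u = (if v = 0 then 2 * m - 1 else v - 1)"
  have u: "u < 2 * m" "Suc u mod (2 * m) = v" using v m by (auto simp: u_def)
  have "e = u" if e: "e < 2 * m" "v = Suc e mod (2 * m)" for e
    using e by (cases "Suc e = 2 * m") (auto simp: u_def)
  then have "C = {v, u}" using u v unfolding C_def by blast
  moreover have "u \<noteq> v" using Suc_mod_neq[OF u(1)] u(2) m by simp
  ultimately have C: "card C = 2" "finite C" by auto
  \<comment> \<open>The number, within each copy, of the matching edge at \<open>v\<close>.\<close>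
  define i where "i = (if v < m then v else inv p (v - m))"
  have i: "i < m"
  proof (cases "v < m")
    case False
    then have "inv p (v - m) < m"
      using v permutes_in_image[OF permutes_inv[OF p], of "v - m"] by simp
    with False show ?thesis by (simp add: i_def)
  qed (simp add: i_def)
  have i_iff: "v = e mod m \<or> v = m + p (e mod m) \<longleftrightarrow> e mod m = i" for e
  proof -
    have e: "e mod m < m" using m by simp
    show ?thesis
    proof (cases "v < m")
      case True
      then show ?thesis by (auto simp: i_def)
    next
      case False
      then have "v = m + p (e mod m) \<longleftrightarrow> p (e mod m) = v - m" by linarith
      also have "\<dots> \<longleftrightarrow> e mod m = inv p (v - m)"
        using permutes_inv_eq[OF p, of "v - m" "e mod m"] by (simp add: eq_commute)
      finally show ?thesis using False e unfolding i_def by simp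
    qed
  qed
  define M where "M = {e. 2 * m \<le> e \<and> e < d * m \<and> e mod m = i}"
  \<comment> \<open>Blocks \<open>0\<close> and \<open>1\<close> of \<open>m\<close> edge numbers
    form the cycle; the copies of the matching are the blocks \<open>2\<close> to
    \<open>d - 1\<close>.\<close>
  have "M = (\<lambda>j. j * m + i) ` {2..<d}"
  proof (rule set_eqI)
    fix e
    show "e \<in> M \<longleftrightarrow> e \<in> (\<lambda>j. j * m + i) ` {2..<d}"
    proof
      assume e: "e \<in> M"
      then have "e = e div m * m + i" by (auto simp: M_def)
      moreover have "2 \<le> e div m" using e m by (simp add: M_def less_eq_div_iff_mult_less_eq)
      moreover have "e div m < d" using e by (simp add: M_def less_mult_imp_div_less)
      ultimately show "e \<in> (\<lambda>j. j * m + i) ` {2..<d}" by (intro image_eqI[of _ _ "e div m"]) auto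
    next
      assume "e \<in> (\<lambda>j. j * m + i) ` {2..<d}"
      then obtain j where "e = j * m + i" "j \<in> {2..<d}" by (rule imageE)
      then have j: "e = j * m + i" "2 \<le> j" "j < d" by simp_all
      have "2 * m \<le> j * m" using j by simp
      then have "2 * m \<le> e" using j(1) by linarith
      moreover have "Suc j * m \<le> d * m" using j by (intro mult_le_mono1) simp
      then have "e < d * m" using j(1) i unfolding mult_Suc by linarith
      moreover have "e mod m = i" unfolding j(1) using i by simp
      ultimately show "e \<in> M" unfolding M_def by blast
    qed
  qed
  moreover have "inj_on (\<lambda>j. j * m + i) {2..<d}" using m by (intro inj_onI) simp
  ultimately have M: "card M = d - 2" "finite M" by (simp_all add: card_image)
  have "{e \<in> edges ?G. v \<in> ends ?G e} = C \<union> M"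
  proof (rule set_eqI)
    fix e
    show "e \<in> {e \<in> edges ?G. v \<in> ends ?G e} \<longleftrightarrow> e \<in> C \<union> M"
    proof (cases "e < 2 * m")
      case True
      then have "e < d * m" using dm by linarith
      with True show ?thesis by (simp add: cycle_matching_def C_def M_def)
    next
      case False
      then have "v \<in> ends ?G e \<longleftrightarrow> e mod m = i"
        unfolding i_iff[of e, symmetric] by (simp add: cycle_matching_def)
      with False show ?thesis by (simp add: cycle_matching_def C_def M_def)
    qed
  qed
  moreover have "C \<inter> M = {}" by (auto simp: C_def M_def)
  ultimately show "degree ?G v = d"
    using card_Un_disjoint[OF C(2) M(2)] C(1) M(1) d by (simp add: degree_def)
qed

text \<open>A boundary index of the cycle is itself an edge number. The crossing index
  \<open>i\<close> becomes the edge \<open>2 * m + i\<close> of the first copy of the matching,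
  which exists since \<open>d \<ge> 3\<close>.\<close>

lemma card_boundary_cycle_matching_ge:
  assumes d: "d \<ge> 3" and p: "p permutes {..<m}" and A: "A \<subseteq> {..<2 * m}"
  shows "card (cycle_boundary (2 * m) A) \<le> card (boundary (cycle_matching d m p) A)"
    and "card (crossing m p A) \<le> card (boundary (cycle_matching d m p) A)"
proof -
  let ?G = "cycle_matching d m p"
  have fin: "finite (boundary ?G A)" by (simp add: boundary_def cycle_matching_def)
  have dm: "3 * m \<le> d * m" using d by simp
  have "e < d * m" if "e < 2 * m" for e using dm that by linarith
  then show "card (cycle_boundary (2 * m) A) \<le> card (boundary ?G A)"
    by (intro card_mono[OF fin]) (auto simp: cycle_boundary_def boundary_def cycle_matching_def)
  have "2 * m + i < d * m" if "i < m" for i using dm that by linarith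
  then have "(\<lambda>i. 2 * m + i) ` crossing m p A \<subseteq> boundary ?G A"
    by (auto simp: crossing_def boundary_def cycle_matching_def)
  then have "card ((\<lambda>i. 2 * m + i) ` crossing m p A) \<le> card (boundary ?G A)"
    by (rule card_mono[OF fin])
  then show "card (crossing m p A) \<le> card (boundary ?G A)" by (simp add: card_image)
qed

section \<open>Choice of the parameters\<close>

lemma ex_regular_graph_large_sn:
  assumes d: "d \<ge> 3" and k: "k \<ge> 1"
  shows "\<exists>G :: (nat, nat) mgraph. graph G \<and> regular d G \<and> card (verts G) = 256 * d * k \<and> k < sn G"
proof -
  \<comment> \<open>The mixing permutation is taken with \<open>t = d * k\<close>, the boundary size
    that \<open>sn_lower_bound\<close> requires to be exceeded.\<close>
  define m where "m = 128 * (d * k)"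
  have "d * k \<ge> 1" using d k by (simp add: Suc_le_eq)
  then obtain p where p: "p permutes {..<m}"
    and mix: "\<And>A. A \<subseteq> {..<2 * m} \<Longrightarrow> m \<le> 2 * card A \<Longrightarrow> card A \<le> m
      \<Longrightarrow> card (cycle_boundary (2 * m) A) \<le> d * k \<Longrightarrow> d * k < card (crossing m p A)"
    using ex_mixing_permutation[OF m_def] by blast
  let ?G = "cycle_matching d m p"
  have m: "m \<ge> 1" using \<open>d * k \<ge> 1\<close> by (simp add: m_def)
  have V: "verts ?G = {..<2 * m}" by (simp add: cycle_matching_def)
  have card_V: "card (verts ?G) = 256 * d * k" unfolding V by (simp add: m_def)
  have G: "graph ?G" "regular d ?G"
    using graph_cycle_matching regular_cycle_matching d m p by auto
  moreover have "k < sn ?G"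
  proof (rule sn_lower_bound[OF G])
    have "k \<le> d * k" using d by simp
    then show "4 * k \<le> card (verts ?G)" unfolding card_V by simp
    fix A assume A: "A \<subseteq> verts ?G" "card (verts ?G) \<le> 4 * card A" "2 * card A \<le> card (verts ?G)"
    then show "d * k < card (boundary ?G A)"
      using card_boundary_cycle_matching_ge[OF d p, of A] mix[of A] unfolding V
      by (cases "card (cycle_boundary (2 * m) A) \<le> d * k") auto
  qed
  ultimately show ?thesis using card_V by blast
qed

theorem theorem1p2:
  fixes d :: nat
  assumes "d \<ge> 3"
  shows "\<exists>(G :: nat \<Rightarrow> (nat, nat) mgraph) (c :: real).
    c > 0 \<and>
    (\<forall>i\<ge>1. graph (G i) \<and> regular d (G i)) \<and>
    filterlim (\<lambda>i. card (verts (G i))) at_top sequentially \<and>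
    (\<forall>i\<ge>1. real (sn (G i)) \<ge> c * real (card (verts (G i)))) \<and>
    (\<forall>i\<ge>1. real (cart (G i)) \<ge> 2 powr (c * sqrt (real (card (verts (G i))))))"
proof -
  \<comment> \<open>The parameter is \<open>k = Suc i\<close>, so that index \<open>0\<close> also
    gives a graph.\<close>
  have "\<forall>i. \<exists>G :: (nat, nat) mgraph. graph G \<and> regular d G
      \<and> card (verts G) = 256 * d * Suc i \<and> Suc i < sn G"
    by (intro allI ex_regular_graph_large_sn[OF assms]) simp
  then obtain G :: "nat \<Rightarrow> (nat, nat) mgraph"
    where G: "\<And>i. graph (G i)" "\<And>i. regular d (G i)"
      and n: "\<And>i. card (verts (G i)) = 256 * d * Suc i" and sn: "\<And>i. Suc i < sn (G i)"
    using choice[of "\<lambda>i G. graph G \<and> regular d G \<and> card (verts G) = 256 * d * Suc i \<and> Suc i < sn G"]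
    by blast
  \<comment> \<open>With \<open>n = 256 * d * k\<close> the exponent
    \<open>k\<^sup>2 / (d * n)\<close> of the carton bound equals
    \<open>n / (65536 * d ^ 3)\<close>.\<close>
  define c :: real where "c = 1 / (65536 * d ^ 3)"
  have c: "c > 0" using assms by (simp add: c_def)
  have "filterlim (\<lambda>i. card (verts (G i))) at_top sequentially"
  proof (rule filterlim_at_top_mono[OF filterlim_Suc])
    have "Suc i \<le> 256 * d * Suc i" for i
      using mult_le_mono1[of 1 "256 * d" "Suc i"] assms by simp
    then show "\<forall>\<^sub>F i in sequentially. Suc i \<le> card (verts (G i))"
      unfolding n by (intro always_eventually allI)
  qed
  moreover have "c * card (verts (G i)) \<le> sn (G i)" for i
  proof -
    have "c * card (verts (G i)) = Suc i / (256 * d\<^sup>2)"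
      using assms unfolding n c_def by (simp add: field_simps power3_eq_cube power2_eq_square)
    also have "\<dots> \<le> Suc i / 1"
    proof (intro divide_left_mono)
      have "1 \<le> (real d)\<^sup>2" using assms by (intro one_le_power) simp
      then show "1 \<le> real (256 * d\<^sup>2)"
        unfolding of_nat_mult of_nat_power of_nat_numeral by linarith
    qed (use assms in auto)
    also have "\<dots> = Suc i" by simp
    also have "\<dots> \<le> sn (G i)" using sn[of i] by simp
    finally show ?thesis .
  qed
  moreover have "2 powr (c * sqrt (card (verts (G i)))) \<le> cart (G i)" for i
  proof -
    let ?n = "real (card (verts (G i)))"
    have "0 < card (verts (G i))" using assms unfolding n by simp
    then have "?n \<ge> 1" by linarith
    \<comment> \<open>The exponent obtained is linear in \<open>n\<close>; it is weakened to the
      square root.\<close>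
    then have "sqrt ?n \<le> sqrt (?n\<^sup>2)" by (intro real_sqrt_le_mono self_le_power) auto
    then have "sqrt ?n \<le> ?n" by simp
    then have "c * sqrt ?n \<le> c * ?n" using c by simp
    also have "\<dots> = (real (Suc i))\<^sup>2 / (d * card (verts (G i)))"
    proof -
      have "c * (256 * real d * x) = x\<^sup>2 / (d * (256 * real d * x))" if "x > 0" for x
        using assms that by (simp add: c_def field_simps power3_eq_cube power2_eq_square)
      then show ?thesis
        using of_nat_0_less_iff[of "Suc i"] unfolding n of_nat_mult of_nat_numeral by blast
    qed
    finally have "2 powr (c * sqrt ?n) \<le> 2 powr ((real (Suc i))\<^sup>2 / (d * card (verts (G i))))"
      by (intro powr_mono) auto
    also have "\<dots> \<le> cart (G i)"
      using cart_lower_bound[OF G, of "Suc i" i] sn assms by simp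
    finally show ?thesis .
  qed
  ultimately show ?thesis using c G by blast
qed

end
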